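(* Let $\mathit{AGT}$ be a set of agents that is an initial subset $\{0,1,\ldots\}$ of $\mathbb{N}$ (possibly $\mathbb{N}$ itself) with $\mathit{Card}(\mathit{AGT})\ge 2$. A formula of $\mathcal{L}_{\mathsf{CSTIT}}^{\mathit{AGT}}$ is valid in Kripke models satisfying the general permutation property if and only if it is provable from the following axiom schemas by the rules of modus ponens and $[i]$-necessitation (for every $i\in\mathit{AGT}$): S5($i$): the axiom schemas of S5 for every $[i]$, $i\in\mathit{AGT}$; Def($\Box$): $\Box\varphi\leftrightarrow[1][0]\varphi$; (GPerm$_k$): $\langle l\rangle\langle m\rangle\varphi\to\langle n\rangle\bigwedge_{i\le k,\ i\neq n}\langle i\rangle\varphi$ for $k\ge 1$, with $l,m,n$ ranging over $\mathit{AGT}$ and $k$ and $i$ over agents.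
   Context: Language. $\mathit{ATM}$ is a countably infinite set of atomic propositions. $\mathcal{L}_{\mathsf{CSTIT}}^{\mathit{AGT}}$ is given by $\varphi ::= p\mid\lnot\varphi\mid(\varphi\land\varphi)\mid[i]\varphi\mid\Box\varphi$ with $p\in\mathit{ATM}$, $i\in\mathit{AGT}$; other boolean connectives are abbreviations, and $\langle i\rangle\varphi$ abbreviates $\lnot[i]\lnot\varphi$. Kripke models. A Kripke model is $M=\langle W,R,V\rangle$ where $W$ is a nonempty set, $R$ associates to every $i\in\mathit{AGT}$ an equivalence relation $R_i$ on $W$, and $V$ maps $\mathit{ATM}$ to subsets of $W$. $R$ satisfies the general permutation property iff for all $w,v\in W$ and all $l,m,n\in\mathit{AGT}$, if $\langle w,v\rangle\in R_l\circ R_m$ then there is $u\in W$ such that $\langle w,u\rangle\in R_n$ and $\langle u,v\rangle\in R_i$ for every $i\in\mathit{AGT}\setminus\{n\}$. (Here $\langle w,v\rangle\in R_l\circ R_m$ iff there is $x$ with $\langle w,x\rangle\in R_l$ and $\langle x,v\rangle\in R_m$.) Truth: $M,w\models p$ iff $w\in V(p)$; booleans as usual; $M,w\models[i]\varphi$ iff $M,u\models\varphi$ for every $u$ with $\langle w,u\rangle\in R_i$; and $\Box\varphi$ is interpreted as an abbreviation of $[1][0]\varphi$. Validity means truth at every world of every such model. Axiomatics. S5($i$) denotes the usual axiom schemas of the normal modal logic S5 for $[i]$, over classical propositional logic. $[i]$-necessitation: from $\varphi$ infer $[i]\varphi$. *)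

theory Defs
  imports Main "HOL-Library.Countable" "HOL-Library.Infinite_Typeclass"
begin

section \<open>Language\<close>

text \<open>Agents are natural numbers. The datatype allows every number as an agent; the language over
  a set of agents \<open>AGT\<close> is carved out by \<open>lang AGT\<close>.\<close>

datatype 'p fm =
    Atm 'p
  | Neg "'p fm"
  | And "'p fm" "'p fm"
  | Stit nat "'p fm"
  | Box "'p fm"

primrec agents :: "'p fm \<Rightarrow> nat set" where
  "agents (Atm p) = {}"
| "agents (Neg \<phi>) = agents \<phi>"
| "agents (And \<phi> \<psi>) = agents \<phi> \<union> agents \<psi>"
| "agents (Stit i \<phi>) = insert i (agents \<phi>)"
| "agents (Box \<phi>) = agents \<phi>"

definition lang :: "nat set \<Rightarrow> 'p fm set" where
  "lang AGT = {\<phi>. agents \<phi> \<subseteq> AGT}"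

abbreviation Imp :: "'p fm \<Rightarrow> 'p fm \<Rightarrow> 'p fm" where
  "Imp \<phi> \<psi> \<equiv> Neg (And \<phi> (Neg \<psi>))"

abbreviation Iff :: "'p fm \<Rightarrow> 'p fm \<Rightarrow> 'p fm" where
  "Iff \<phi> \<psi> \<equiv> And (Imp \<phi> \<psi>) (Imp \<psi> \<phi>)"

abbreviation Dia :: "nat \<Rightarrow> 'p fm \<Rightarrow> 'p fm" where
  "Dia i \<phi> \<equiv> Neg (Stit i (Neg \<phi>))"

text \<open>Conjunction of a nonempty list. The empty conjunction is left unspecified: it does not arise
  in \<open>GPerm\<close> below, where \<open>k \<ge> 1\<close>, so that 0 or 1 differs from \<open>n\<close>.\<close>

fun BigAnd :: "'p fm list \<Rightarrow> 'p fm" where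
  "BigAnd [\<phi>] = \<phi>"
| "BigAnd (\<phi> # \<psi> # \<Phi>) = And \<phi> (BigAnd (\<psi> # \<Phi>))"

section \<open>Kripke models\<close>

record ('w, 'p) model =
  worlds :: "'w set"
  rel :: "nat \<Rightarrow> ('w \<times> 'w) set"
  val :: "'p \<Rightarrow> 'w set"

definition kripke_model :: "nat set \<Rightarrow> ('w, 'p) model \<Rightarrow> bool" where
  "kripke_model AGT M \<longleftrightarrow>
     worlds M \<noteq> {} \<and>
     (\<forall>i\<in>AGT. equiv (worlds M) (rel M i)) \<and>
     (\<forall>p. val M p \<subseteq> worlds M)"

definition general_permutation :: "nat set \<Rightarrow> ('w, 'p) model \<Rightarrow> bool" where
  "general_permutation AGT M \<longleftrightarrow>
     (\<forall>w\<in>worlds M. \<forall>v\<in>worlds M. \<forall>l\<in>AGT. \<forall>m\<in>AGT. \<forall>n\<in>AGT.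
        (w, v) \<in> rel M l O rel M m \<longrightarrow>
        (\<exists>u\<in>worlds M. (w, u) \<in> rel M n \<and> (\<forall>i\<in>AGT - {n}. (u, v) \<in> rel M i)))"

primrec sat :: "('w, 'p) model \<Rightarrow> 'w \<Rightarrow> 'p fm \<Rightarrow> bool" where
  "sat M w (Atm p) \<longleftrightarrow> w \<in> val M p"
| "sat M w (Neg \<phi>) \<longleftrightarrow> \<not> sat M w \<phi>"
| "sat M w (And \<phi> \<psi>) \<longleftrightarrow> sat M w \<phi> \<and> sat M w \<psi>"
| "sat M w (Stit i \<phi>) \<longleftrightarrow> (\<forall>u. (w, u) \<in> rel M i \<longrightarrow> sat M u \<phi>)"
| "sat M w (Box \<phi>) \<longleftrightarrow>
     (\<forall>v. (w, v) \<in> rel M 1 \<longrightarrow> (\<forall>u. (v, u) \<in> rel M 0 \<longrightarrow> sat M u \<phi>))"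

text \<open>The last clause is primitive recursive only because the two modalities are unfolded.\<close>

lemma sat_Box: "sat M w (Box \<phi>) \<longleftrightarrow> sat M w (Stit 1 (Stit 0 \<phi>))"
  by simp

text \<open>HOL cannot quantify over types inside a formula, so the type of which the sets of worlds are
  subsets is a parameter. Every model is isomorphic to one over some infinite type.\<close>

definition valid :: "'w itself \<Rightarrow> nat set \<Rightarrow> 'p fm \<Rightarrow> bool" where
  "valid (_ :: 'w itself) AGT \<phi> \<longleftrightarrow>
     (\<forall>M :: ('w, 'p) model. kripke_model AGT M \<and> general_permutation AGT M \<longrightarrow>
        (\<forall>w\<in>worlds M. sat M w \<phi>))"

section \<open>Axiomatics\<close>

text \<open>Propositional evaluation: atoms and modal formulas are assigned arbitrary truth values, so
  the tautologies are exactly the substitution instances of classical tautologies.\<close>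

primrec peval :: "('p fm \<Rightarrow> bool) \<Rightarrow> 'p fm \<Rightarrow> bool" where
  "peval g (Atm p) \<longleftrightarrow> g (Atm p)"
| "peval g (Neg \<phi>) \<longleftrightarrow> \<not> peval g \<phi>"
| "peval g (And \<phi> \<psi>) \<longleftrightarrow> peval g \<phi> \<and> peval g \<psi>"
| "peval g (Stit i \<phi>) \<longleftrightarrow> g (Stit i \<phi>)"
| "peval g (Box \<phi>) \<longleftrightarrow> g (Box \<phi>)"

definition tautology :: "'p fm \<Rightarrow> bool" where
  "tautology \<phi> \<longleftrightarrow> (\<forall>g. peval g \<phi>)"

inductive provable :: "nat set \<Rightarrow> 'p fm \<Rightarrow> bool" for AGT where
  Taut: "\<lbrakk>\<phi> \<in> lang AGT; tautology \<phi>\<rbrakk> \<Longrightarrow> provable AGT \<phi>"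
| K: "\<lbrakk>i \<in> AGT; \<phi> \<in> lang AGT; \<psi> \<in> lang AGT\<rbrakk>
    \<Longrightarrow> provable AGT (Imp (Stit i (Imp \<phi> \<psi>)) (Imp (Stit i \<phi>) (Stit i \<psi>)))"
| T: "\<lbrakk>i \<in> AGT; \<phi> \<in> lang AGT\<rbrakk> \<Longrightarrow> provable AGT (Imp (Stit i \<phi>) \<phi>)"
| Four: "\<lbrakk>i \<in> AGT; \<phi> \<in> lang AGT\<rbrakk> \<Longrightarrow> provable AGT (Imp (Stit i \<phi>) (Stit i (Stit i \<phi>)))"
| Five: "\<lbrakk>i \<in> AGT; \<phi> \<in> lang AGT\<rbrakk> \<Longrightarrow> provable AGT (Imp (Dia i \<phi>) (Stit i (Dia i \<phi>)))"
| DefBox: "\<phi> \<in> lang AGT \<Longrightarrow> provable AGT (Iff (Box \<phi>) (Stit 1 (Stit 0 \<phi>)))"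
| GPerm: "\<lbrakk>k \<in> AGT; k \<ge> 1; l \<in> AGT; m \<in> AGT; n \<in> AGT; \<phi> \<in> lang AGT\<rbrakk>
    \<Longrightarrow> provable AGT
          (Imp (Dia l (Dia m \<phi>))
               (Dia n (BigAnd (map (\<lambda>i. Dia i \<phi>) (filter (\<lambda>i. i \<noteq> n) [0..<Suc k])))))"
| MP: "\<lbrakk>provable AGT \<phi>; provable AGT (Imp \<phi> \<psi>)\<rbrakk> \<Longrightarrow> provable AGT \<psi>"
| Nec: "\<lbrakk>i \<in> AGT; provable AGT \<phi>\<rbrakk> \<Longrightarrow> provable AGT (Stit i \<phi>)"

end

theory Submission
  imports Defs
begin

text \<open>Completeness goes through the canonical model, whose worlds are the maximal consistent sets.
  It has the general permutation property even for infinitely many agents: by (GPerm) every finite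
  part of the theory required of the intermediate world \<open>u\<close> is contained in some maximal consistent
  set, so the whole of it is consistent. The canonical model is uncountable, whereas the type of
  worlds may be any infinite type. Hence we pass to a countable submodel, closed under witnesses for
  the modalities and for the permutation property (a Skolem hull); its worlds are the values of the
  terms of a countable datatype, onto which every infinite type can be mapped.\<close>

section \<open>Propositional reasoning\<close>

instance fm :: (countable) countable
  by countable_datatype

text \<open>The language has no falsum. Since an atom mentions no agent, this contradiction lies in
  \<open>lang A\<close> for every \<open>A\<close>.\<close>

definition Bot :: "'p fm" where
  "Bot = And (Atm undefined) (Neg (Atm undefined))"

text \<open>Premises are chained by implication rather than conjoined, because the list may be empty
  and \<open>BigAnd []\<close> is unspecified.\<close>

abbreviation Imps :: "'p fm list \<Rightarrow> 'p fm \<Rightarrow> 'p fm" where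
  "Imps \<Gamma> \<phi> \<equiv> foldr (\<lambda>\<psi> \<chi>. Imp \<psi> \<chi>) \<Gamma> \<phi>"

lemma lang_simps [simp]:
  "Atm p \<in> lang A"
  "Neg \<phi> \<in> lang A \<longleftrightarrow> \<phi> \<in> lang A"
  "And \<phi> \<psi> \<in> lang A \<longleftrightarrow> \<phi> \<in> lang A \<and> \<psi> \<in> lang A"
  "Stit i \<phi> \<in> lang A \<longleftrightarrow> i \<in> A \<and> \<phi> \<in> lang A"
  "Box \<phi> \<in> lang A \<longleftrightarrow> \<phi> \<in> lang A"
  "Bot \<in> lang A"
  by (auto simp: lang_def Bot_def)

lemma Imps_in_lang [simp]: "Imps \<Gamma> \<phi> \<in> lang A \<longleftrightarrow> set \<Gamma> \<subseteq> lang A \<and> \<phi> \<in> lang A"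
  by (induction \<Gamma>) auto

lemma peval_Imps [simp]: "peval g (Imps \<Gamma> \<phi>) \<longleftrightarrow> ((\<forall>\<gamma>\<in>set \<Gamma>. peval g \<gamma>) \<longrightarrow> peval g \<phi>)"
  by (induction \<Gamma>) auto

lemma peval_Bot [simp]: "\<not> peval g Bot"
  by (simp add: Bot_def)

lemma BigAnd_in_lang:
  "\<Phi> \<noteq> [] \<Longrightarrow> BigAnd \<Phi> \<in> lang A \<longleftrightarrow> set \<Phi> \<subseteq> lang A"
  by (induction \<Phi> rule: BigAnd.induct) auto

lemma sat_BigAnd:
  "\<Phi> \<noteq> [] \<Longrightarrow> sat M w (BigAnd \<Phi>) \<longleftrightarrow> (\<forall>\<phi>\<in>set \<Phi>. sat M w \<phi>)"
  by (induction \<Phi> rule: BigAnd.induct) auto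

text \<open>Truth at a world is one particular propositional evaluation; this is why tautologies are
  sound.\<close>

lemma peval_sat: "peval (sat M w) \<phi> \<longleftrightarrow> sat M w \<phi>"
  by (induction \<phi>) auto

lemma set_gperm_list:
  "set (map f (filter (\<lambda>i. i \<noteq> n) [0..<Suc k])) = f ` {i. i \<le> k \<and> i \<noteq> n}"
  by (auto simp: less_Suc_eq_le simp del: upt_Suc)

lemma gperm_list_nonempty:
  assumes "k \<ge> (1::nat)"
  shows "map f (filter (\<lambda>i. i \<noteq> n) [0..<Suc k]) \<noteq> []"
proof -
  have "(if n = 0 then 1 else 0) \<in> {i. i \<le> k \<and> i \<noteq> n}"
    using assms by auto
  then have "f ` {i. i \<le> k \<and> i \<noteq> n} \<noteq> {}"
    by blast
  then show ?thesis
    by (metis set_gperm_list list.set(1))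
qed

text \<open>For an initial segment, having at least two members amounts to containing
  \<open>1\<close>, which is the form needed for \<open>DefBox\<close> and for the bound
  \<open>k \<ge> 1\<close>.\<close>

locale agent_set =
  fixes AGT :: "nat set"
  assumes initial: "i \<in> AGT \<Longrightarrow> j \<le> i \<Longrightarrow> j \<in> AGT"
    and one_agent: "1 \<in> AGT"
begin

lemma zero_agent: "0 \<in> AGT"
  using initial one_agent by blast

section \<open>Soundness\<close>

lemma soundness:
  assumes "provable AGT \<phi>" "kripke_model AGT M" "general_permutation AGT M" "w \<in> worlds M"
  shows "sat M w \<phi>"
  using assms(1,4)
proof (induction arbitrary: w)
  case (Taut \<phi>)
  then show ?case
    by (simp add: tautology_def flip: peval_sat[of M w])
next
  case (T i \<phi>)
  then show ?case
    using assms(2) by (auto simp: kripke_model_def equiv_def refl_on_def)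
next
  case (Four i \<phi>)
  then have "trans (rel M i)"
    using assms(2) by (auto simp: kripke_model_def equiv_def)
  then show ?case
    by (auto dest: transD)
next
  case (Five i \<phi>)
  then have "trans (rel M i)" "sym (rel M i)"
    using assms(2) by (auto simp: kripke_model_def equiv_def)
  then show ?case
    by simp (metis symD transD)
next
  case (GPerm k l m n \<phi>)
  let ?\<Phi> = "map (\<lambda>i. Dia i \<phi>) (filter (\<lambda>i. i \<noteq> n) [0..<Suc k])"
  have eq: "equiv (worlds M) (rel M i)" if "i \<in> AGT" for i
    using assms(2) that by (auto simp: kripke_model_def)
  have "sat M w (Dia n (BigAnd ?\<Phi>))" if "sat M w (Dia l (Dia m \<phi>))"
  proof -
    from that obtain v where v: "(w, v) \<in> rel M l O rel M m" "sat M v \<phi>"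
      by auto
    then have "v \<in> worlds M"
      using eq[OF \<open>m \<in> AGT\<close>] by (auto simp: equiv_def)
    \<comment> \<open>One \<open>u\<close> serves all agents other than \<open>n\<close> at once,
      hence every conjunct whatever \<open>k\<close> is. Below, \<open>initial\<close> makes each
      \<open>i \<le> k\<close> an agent.\<close>
    then obtain u where u: "(w, u) \<in> rel M n" "\<forall>i\<in>AGT - {n}. (u, v) \<in> rel M i"
      using assms(3) GPerm v(1) unfolding general_permutation_def by meson
    have "\<forall>\<psi>\<in>set ?\<Phi>. sat M u \<psi>"
    proof
      fix \<psi>
      assume "\<psi> \<in> set ?\<Phi>"
      then obtain i where "i \<le> k" "i \<noteq> n" "\<psi> = Dia i \<phi>"
        unfolding set_gperm_list by blast
      moreover from this have "(u, v) \<in> rel M i"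
        using u(2) initial[OF \<open>k \<in> AGT\<close>] by blast
      ultimately show "sat M u \<psi>"
        using v(2) by auto
    qed
    then have "sat M u (BigAnd ?\<Phi>)"
      by (rule iffD2[OF sat_BigAnd[OF gperm_list_nonempty[OF \<open>k \<ge> 1\<close>]]])
    then show ?thesis
      using u(1) by (auto simp del: upt_Suc)
  qed
  then have "sat M w (Dia l (Dia m \<phi>)) \<longrightarrow> sat M w (Dia n (BigAnd ?\<Phi>))"
    by (rule impI)
  then show ?case
    by (auto simp del: upt_Suc)
next
  case (Nec i \<phi>)
  then show ?case
    using assms(2) by (auto simp: kripke_model_def equiv_def)
qed auto

section \<open>Maximal consistent sets\<close>

lemma provable_in_lang: "provable AGT \<phi> \<Longrightarrow> \<phi> \<in> lang AGT"
proof (induction rule: provable.induct)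
  case (GPerm k l m n \<phi>)
  have "set (map (\<lambda>i. Dia i \<phi>) (filter (\<lambda>i. i \<noteq> n) [0..<Suc k])) \<subseteq> lang AGT"
    unfolding set_gperm_list using GPerm initial[OF \<open>k \<in> AGT\<close>] by auto
  moreover have "map (\<lambda>i. Dia i \<phi>) (filter (\<lambda>i. i \<noteq> n) [0..<Suc k]) \<noteq> []"
    using gperm_list_nonempty[OF \<open>k \<ge> 1\<close>] .
  ultimately have "BigAnd (map (\<lambda>i. Dia i \<phi>) (filter (\<lambda>i. i \<noteq> n) [0..<Suc k])) \<in> lang AGT"
    using BigAnd_in_lang by blast
  then show ?case
    using GPerm by (simp del: upt_Suc)
qed (use one_agent zero_agent in auto)

lemma provable_Imps:
  "\<forall>\<gamma>\<in>set \<Gamma>. provable AGT \<gamma> \<Longrightarrow> provable AGT (Imps \<Gamma> \<phi>) \<Longrightarrow> provable AGT \<phi>"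
  by (induction \<Gamma>) (auto intro: MP)

text \<open>Propositional steps between theorems reduce to checking evaluations: the chained
  implication is a tautology, and modus ponens discharges the premises.\<close>

lemma provable_consequence:
  assumes "\<forall>\<gamma>\<in>set \<Gamma>. provable AGT \<gamma>" "\<phi> \<in> lang AGT"
    and "\<And>g. \<forall>\<gamma>\<in>set \<Gamma>. peval g \<gamma> \<Longrightarrow> peval g \<phi>"
  shows "provable AGT \<phi>"
proof (rule provable_Imps[OF assms(1)])
  show "provable AGT (Imps \<Gamma> \<phi>)"
    using assms provable_in_lang by (intro Taut) (auto simp: tautology_def)
qed

definition consistent :: "'p fm set \<Rightarrow> bool" where
  "consistent S \<longleftrightarrow> S \<subseteq> lang AGT \<and> (\<forall>\<Gamma>. set \<Gamma> \<subseteq> S \<longrightarrow> \<not> provable AGT (Imps \<Gamma> Bot))"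

definition mcs :: "'p fm set \<Rightarrow> bool" where
  "mcs X \<longleftrightarrow> consistent X \<and> (\<forall>\<phi>\<in>lang AGT. \<phi> \<in> X \<or> Neg \<phi> \<in> X)"

lemma consistent_subset: "consistent X \<Longrightarrow> S \<subseteq> X \<Longrightarrow> consistent S"
  unfolding consistent_def by blast

lemma consistentD: "consistent S \<Longrightarrow> set \<Gamma> \<subseteq> S \<Longrightarrow> \<not> provable AGT (Imps \<Gamma> Bot)"
  by (simp add: consistent_def)

lemma mcs_consistent: "mcs X \<Longrightarrow> consistent X"
  by (simp add: mcs_def)

text \<open>A refutation uses only finitely many premises. This compactness serves both the chains
  in Zorn's lemma and the permutation witness, whose possibly infinitely many demands are met
  finitely many at a time.\<close>

lemma consistent_finitary:
  assumes "\<And>F. finite F \<Longrightarrow> F \<subseteq> S \<Longrightarrow> consistent F"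
  shows "consistent S"
proof -
  have "\<phi> \<in> lang AGT" if "\<phi> \<in> S" for \<phi>
    using assms[of "{\<phi>}"] that by (simp add: consistent_def)
  moreover have "\<not> provable AGT (Imps \<Gamma> Bot)" if "set \<Gamma> \<subseteq> S" for \<Gamma>
    using consistentD[OF assms[OF finite_set that]] by blast
  ultimately show ?thesis
    unfolding consistent_def by blast
qed

text \<open>A form of the deduction theorem: deleting the occurrences of \<open>\<phi>\<close> from
  the premises of a refutation leaves a derivation of its negation.\<close>

lemma inconsistent_insertD:
  assumes "S \<subseteq> lang AGT" "\<phi> \<in> lang AGT" "\<not> consistent (insert \<phi> S)"
  obtains \<Gamma> where "set \<Gamma> \<subseteq> S" "provable AGT (Imps \<Gamma> (Neg \<phi>))"
proof -
  from assms obtain \<Gamma> where \<Gamma>: "set \<Gamma> \<subseteq> insert \<phi> S" "provable AGT (Imps \<Gamma> Bot)"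
    unfolding consistent_def by auto
  let ?\<Gamma> = "filter (\<lambda>\<psi>. \<psi> \<noteq> \<phi>) \<Gamma>"
  have "provable AGT (Imps ?\<Gamma> (Neg \<phi>))"
  proof (rule provable_consequence[of "[Imps \<Gamma> Bot]"])
    show "Imps ?\<Gamma> (Neg \<phi>) \<in> lang AGT"
      using assms(1,2) \<Gamma>(1) by auto
  qed (use \<Gamma>(2) in auto)
  moreover have "set ?\<Gamma> \<subseteq> S"
    using \<Gamma>(1) by auto
  ultimately show ?thesis
    using that by blast
qed

lemma consistent_insert_or_Neg:
  assumes "consistent S" "\<phi> \<in> lang AGT"
  shows "consistent (insert \<phi> S) \<or> consistent (insert (Neg \<phi>) S)"
proof (rule ccontr)
  assume neg: "\<not> ?thesis"
  have S: "S \<subseteq> lang AGT"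
    using assms(1) by (simp add: consistent_def)
  obtain \<Gamma> where \<Gamma>: "set \<Gamma> \<subseteq> S" "provable AGT (Imps \<Gamma> (Neg \<phi>))"
    using inconsistent_insertD[OF S assms(2)] neg by blast
  obtain \<Delta> where \<Delta>: "set \<Delta> \<subseteq> S" "provable AGT (Imps \<Delta> (Neg (Neg \<phi>)))"
    using inconsistent_insertD[OF S, of "Neg \<phi>"] assms(2) neg by auto
  have "provable AGT (Imps (\<Gamma> @ \<Delta>) Bot)"
    by (rule provable_consequence[of "[Imps \<Gamma> (Neg \<phi>), Imps \<Delta> (Neg (Neg \<phi>))]"])
      (use \<Gamma> \<Delta> S in \<open>auto simp del: foldr_append\<close>)
  moreover have "set (\<Gamma> @ \<Delta>) \<subseteq> S"
    using \<Gamma> \<Delta> by auto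
  ultimately show False
    using consistentD[OF assms(1)] by blast
qed

text \<open>Zorn's lemma applies because consistency is finitary. A maximal element decides every
  formula, as one of the two one-step extensions is consistent.\<close>

lemma lindenbaum:
  assumes "consistent S"
  obtains X where "mcs X" "S \<subseteq> X"
proof -
  let ?A = "{X. consistent X \<and> S \<subseteq> X}"
  have "\<exists>X\<in>?A. \<forall>Y\<in>?A. X \<subseteq> Y \<longrightarrow> Y = X"
  proof (rule subset_Zorn_nonempty)
    show "?A \<noteq> {}"
      using assms by blast
  next
    fix C
    assume C: "C \<noteq> {}" "subset.chain ?A C"
    have "consistent (\<Union> C)"
    proof (rule consistent_finitary)
      fix F
      assume "finite F" "F \<subseteq> \<Union> C"
      then obtain X where "X \<in> C" "F \<subseteq> X"
        using finite_subset_Union_chain C by blast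
      then show "consistent F"
        using C(2) by (auto simp: subset.chain_def intro: consistent_subset)
    qed
    moreover have "S \<subseteq> \<Union> C"
      using C unfolding subset.chain_def by blast
    ultimately show "\<Union> C \<in> ?A"
      by blast
  qed
  then obtain X where X: "consistent X" "S \<subseteq> X"
    and max: "\<forall>Y\<in>?A. X \<subseteq> Y \<longrightarrow> Y = X"
    by blast
  have "\<phi> \<in> X \<or> Neg \<phi> \<in> X" if "\<phi> \<in> lang AGT" for \<phi>
    using consistent_insert_or_Neg[OF X(1) that] max X(2) by blast
  then show ?thesis
    using that X unfolding mcs_def by blast
qed

section \<open>Closure properties of maximal consistent sets\<close>

lemma mcs_in_lang: "mcs X \<Longrightarrow> \<phi> \<in> X \<Longrightarrow> \<phi> \<in> lang AGT"
  by (auto simp: mcs_def consistent_def)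

lemma mcs_Imps:
  assumes "mcs X" "set \<Gamma> \<subseteq> X" "provable AGT (Imps \<Gamma> \<phi>)"
  shows "\<phi> \<in> X"
proof (rule ccontr)
  assume "\<phi> \<notin> X"
  have lang: "set \<Gamma> \<subseteq> lang AGT" "\<phi> \<in> lang AGT"
    using provable_in_lang[OF assms(3)] by simp_all
  then have "set (Neg \<phi> # \<Gamma>) \<subseteq> X"
    using assms(1,2) \<open>\<phi> \<notin> X\<close> by (auto simp: mcs_def)
  moreover have "provable AGT (Imps (Neg \<phi> # \<Gamma>) Bot)"
    by (rule provable_consequence[of "[Imps \<Gamma> \<phi>]"]) (use lang assms(3) in auto)
  ultimately show False
    using consistentD[OF mcs_consistent[OF assms(1)]] by blast
qed

lemma mcs_consequence:
  assumes "mcs X" "set \<Gamma> \<subseteq> X" "\<phi> \<in> lang AGT"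
    and "\<And>g. \<forall>\<gamma>\<in>set \<Gamma>. peval g \<gamma> \<Longrightarrow> peval g \<phi>"
  shows "\<phi> \<in> X"
  using assms(1,2)
proof (rule mcs_Imps)
  have "set \<Gamma> \<subseteq> lang AGT"
    using assms(2) mcs_in_lang[OF assms(1)] by blast
  then show "provable AGT (Imps \<Gamma> \<phi>)"
    using assms(3,4) by (intro Taut) (auto simp: tautology_def)
qed

lemma mcs_provable: "mcs X \<Longrightarrow> provable AGT \<phi> \<Longrightarrow> \<phi> \<in> X"
  by (rule mcs_Imps[of X "[]"]) simp_all

lemma mcs_Imp: "mcs X \<Longrightarrow> provable AGT (Imp \<phi> \<psi>) \<Longrightarrow> \<phi> \<in> X \<Longrightarrow> \<psi> \<in> X"
  by (rule mcs_Imps[of X "[\<phi>]"]) simp_all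

lemma mcs_Neg:
  assumes "mcs X" "\<phi> \<in> lang AGT"
  shows "Neg \<phi> \<in> X \<longleftrightarrow> \<phi> \<notin> X"
proof -
  have "\<not> (\<phi> \<in> X \<and> Neg \<phi> \<in> X)"
  proof
    assume "\<phi> \<in> X \<and> Neg \<phi> \<in> X"
    then have sub: "set [\<phi>, Neg \<phi>] \<subseteq> X"
      by simp
    moreover have "provable AGT (Imps [\<phi>, Neg \<phi>] Bot)"
      using assms(2) by (intro Taut) (auto simp: tautology_def)
    ultimately show False
      using consistentD[OF mcs_consistent[OF assms(1)]] by blast
  qed
  then show ?thesis
    using assms by (auto simp: mcs_def)
qed

lemma mcs_And:
  assumes "mcs X"
  shows "And \<phi> \<psi> \<in> X \<longleftrightarrow> \<phi> \<in> X \<and> \<psi> \<in> X"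
proof
  assume *: "And \<phi> \<psi> \<in> X"
  then show "\<phi> \<in> X \<and> \<psi> \<in> X"
    using mcs_in_lang[OF assms *] mcs_consequence[OF assms, of "[And \<phi> \<psi>]"] by auto
next
  assume *: "\<phi> \<in> X \<and> \<psi> \<in> X"
  then show "And \<phi> \<psi> \<in> X"
    using mcs_in_lang[OF assms] by (intro mcs_consequence[OF assms, of "[\<phi>, \<psi>]"]) auto
qed

lemma mcs_BigAnd:
  "mcs X \<Longrightarrow> \<Phi> \<noteq> [] \<Longrightarrow> BigAnd \<Phi> \<in> X \<longleftrightarrow> set \<Phi> \<subseteq> X"
  by (induction \<Phi> rule: BigAnd.induct) (auto simp: mcs_And)

lemma mcs_Box:
  assumes "mcs X" "\<phi> \<in> lang AGT"
  shows "Box \<phi> \<in> X \<longleftrightarrow> Stit 1 (Stit 0 \<phi>) \<in> X"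
proof -
  have "Iff (Box \<phi>) (Stit 1 (Stit 0 \<phi>)) \<in> X"
    using mcs_provable[OF assms(1) DefBox[OF assms(2)]] .
  then show ?thesis
    using assms one_agent zero_agent by (auto simp: mcs_And mcs_Neg)
qed

section \<open>The canonical accessibility relations\<close>

text \<open>Demanding the same \<open>Stit i\<close> formulas makes this an equivalence on arbitrary
  sets. For agents and maximal consistent sets it agrees with the usual one-sided condition, by
  \<open>accessI\<close> and \<open>access_StitD\<close>.\<close>

definition access :: "nat \<Rightarrow> 'p fm set \<Rightarrow> 'p fm set \<Rightarrow> bool" where
  "access i X Y \<longleftrightarrow> (\<forall>\<phi>. Stit i \<phi> \<in> X \<longleftrightarrow> Stit i \<phi> \<in> Y)"

lemma access_sym: "access i X Y \<Longrightarrow> access i Y X"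
  by (simp add: access_def)

lemma mcs_Stit_Imps:
  assumes "mcs X" "i \<in> AGT"
  shows "Stit i (Imps \<Gamma> \<phi>) \<in> X \<Longrightarrow> \<forall>\<gamma>\<in>set \<Gamma>. Stit i \<gamma> \<in> X \<Longrightarrow> Stit i \<phi> \<in> X"
proof (induction \<Gamma>)
  case (Cons \<gamma> \<Gamma>)
  have "\<gamma> \<in> lang AGT" "Imps \<Gamma> \<phi> \<in> lang AGT"
    using mcs_in_lang[OF assms(1) Cons.prems(1)] by auto
  then have "provable AGT (Imps [Stit i (Imp \<gamma> (Imps \<Gamma> \<phi>)), Stit i \<gamma>] (Stit i (Imps \<Gamma> \<phi>)))"
    using K[OF assms(2), of \<gamma> "Imps \<Gamma> \<phi>"] by simp
  then have "Stit i (Imps \<Gamma> \<phi>) \<in> X"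
    by (rule mcs_Imps[OF assms(1), rotated]) (use Cons.prems in auto)
  then show ?case
    using Cons by simp
qed simp

lemma mcs_Stit_mono:
  assumes "mcs X" "i \<in> AGT" "Stit i \<phi> \<in> X" "provable AGT (Imp \<phi> \<psi>)"
  shows "Stit i \<psi> \<in> X"
  using mcs_Stit_Imps[OF assms(1,2), of "[\<phi>]" \<psi>] mcs_provable[OF assms(1) Nec[OF assms(2,4)]]
    assms(3) by simp

lemma mcs_StitD: "mcs X \<Longrightarrow> i \<in> AGT \<Longrightarrow> Stit i \<phi> \<in> X \<Longrightarrow> \<phi> \<in> X"
  using mcs_Imp[OF _ T] mcs_in_lang by fastforce

lemma access_StitD:
  "mcs Y \<Longrightarrow> i \<in> AGT \<Longrightarrow> access i X Y \<Longrightarrow> Stit i \<phi> \<in> X \<Longrightarrow> \<phi> \<in> Y"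
  using mcs_StitD access_def by blast

text \<open>Axiom \<open>Five\<close> is phrased with \<open>Dia\<close>, whose unfolding leaves a
  double negation below \<open>Stit i\<close>; necessitation and \<open>K\<close> remove it.\<close>

lemma mcs_Stit_Neg_Stit:
  assumes "mcs X" "i \<in> AGT" "\<phi> \<in> lang AGT" "Stit i \<phi> \<notin> X"
  shows "Stit i (Neg (Stit i \<phi>)) \<in> X"
proof -
  let ?\<chi> = "Neg (Neg \<phi>)"
  have imp: "provable AGT (Imp ?\<chi> \<phi>)" "provable AGT (Imp \<phi> ?\<chi>)"
    using assms(3) by (auto intro!: Taut simp: tautology_def)
  have "Stit i ?\<chi> \<notin> X"
    using mcs_Stit_mono[OF assms(1,2) _ imp(1)] assms(4) by blast
  then have "Dia i (Neg \<phi>) \<in> X"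
    using mcs_Neg[OF assms(1)] assms(2,3) by simp
  then have "Stit i (Neg (Stit i ?\<chi>)) \<in> X"
    using mcs_Imp[OF assms(1) Five[OF assms(2), of "Neg \<phi>"]] assms(3) by simp
  moreover have "provable AGT (Imp (Neg (Stit i ?\<chi>)) (Neg (Stit i \<phi>)))"
  proof (rule provable_consequence)
    show "\<forall>\<gamma>\<in>set [Imp (Stit i \<phi>) (Stit i ?\<chi>)]. provable AGT \<gamma>"
      using MP[OF Nec[OF assms(2) imp(2)] K[OF assms(2)]] assms(3) by simp
  qed (use assms(2,3) in auto)
  ultimately show ?thesis
    using mcs_Stit_mono[OF assms(1,2)] by blast
qed

text \<open>\<open>Four\<close> carries \<open>Stit i\<close> formulas from \<open>X\<close> to
  \<open>Y\<close>, and negative introspection carries them back.\<close>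

lemma accessI:
  assumes "mcs X" "mcs Y" "i \<in> AGT" "\<And>\<phi>. Stit i \<phi> \<in> X \<Longrightarrow> \<phi> \<in> Y"
  shows "access i X Y"
  unfolding access_def
proof (intro allI iffI)
  fix \<phi>
  assume *: "Stit i \<phi> \<in> X"
  then have "Stit i (Stit i \<phi>) \<in> X"
    using mcs_Imp[OF assms(1) Four[OF assms(3)]] mcs_in_lang[OF assms(1) *] by simp
  then show "Stit i \<phi> \<in> Y"
    by (rule assms(4))
next
  fix \<phi>
  assume *: "Stit i \<phi> \<in> Y"
  then have "\<phi> \<in> lang AGT"
    using mcs_in_lang[OF assms(2)] by fastforce
  moreover have "Neg (Stit i \<phi>) \<notin> Y"
    using * mcs_Neg[OF assms(2) mcs_in_lang[OF assms(2) *]] by simp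
  ultimately show "Stit i \<phi> \<in> X"
    using mcs_Stit_Neg_Stit[OF assms(1,3)] assms(4) by blast
qed

lemma Stit_witness:
  assumes "mcs X" "i \<in> AGT" "\<phi> \<in> lang AGT" "Stit i \<phi> \<notin> X"
  shows "\<exists>Y. mcs Y \<and> access i X Y \<and> \<phi> \<notin> Y"
proof -
  let ?S = "{\<psi>. Stit i \<psi> \<in> X}"
  have S: "?S \<subseteq> lang AGT"
    using mcs_in_lang[OF assms(1)] by fastforce
  have "consistent (insert (Neg \<phi>) ?S)"
  proof (rule ccontr)
    assume "\<not> consistent (insert (Neg \<phi>) ?S)"
    then obtain \<Gamma> where \<Gamma>: "set \<Gamma> \<subseteq> ?S" "provable AGT (Imps \<Gamma> (Neg (Neg \<phi>)))"
      using inconsistent_insertD[OF S, of "Neg \<phi>"] assms(3) by auto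
    have "provable AGT (Imps \<Gamma> \<phi>)"
      by (rule provable_consequence[of "[Imps \<Gamma> (Neg (Neg \<phi>))]"]) (use \<Gamma> S assms(3) in auto)
    \<comment> \<open>Necessitation puts the derivation under \<open>Stit i\<close>, and
      \<open>K\<close> distributes it over the premises, which lie in \<open>?S\<close>.\<close>
    then have "Stit i (Imps \<Gamma> \<phi>) \<in> X"
      using mcs_provable[OF assms(1)] Nec[OF assms(2)] by blast
    then have "Stit i \<phi> \<in> X"
      by (rule mcs_Stit_Imps[OF assms(1,2)]) (use \<Gamma> in auto)
    then show False
      using assms(4) by contradiction
  qed
  then obtain Y where Y: "mcs Y" "insert (Neg \<phi>) ?S \<subseteq> Y"
    by (rule lindenbaum)
  then have "access i X Y"
    by (intro accessI) (use assms in auto)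
  then show ?thesis
    using Y mcs_Neg[OF Y(1) assms(3)] by auto
qed

section \<open>Diamonds and the permutation property of the canonical relations\<close>

lemma access_Dia:
  assumes "mcs X" "mcs Y" "i \<in> AGT" "access i X Y" "\<phi> \<in> Y"
  shows "Dia i \<phi> \<in> X"
proof -
  have \<phi>: "\<phi> \<in> lang AGT"
    using assms mcs_in_lang by blast
  have "Stit i (Neg \<phi>) \<notin> X"
    using access_StitD[OF assms(2,3,4)] mcs_Neg[OF assms(2) \<phi>] assms(5) by blast
  then show ?thesis
    using mcs_Neg[OF assms(1)] \<phi> assms(3) by simp
qed

lemma Dia_witness:
  assumes "mcs X" "i \<in> AGT" "Dia i \<phi> \<in> X"
  shows "\<exists>Y. mcs Y \<and> access i X Y \<and> \<phi> \<in> Y"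
proof -
  have \<phi>: "\<phi> \<in> lang AGT"
    using mcs_in_lang[OF assms(1,3)] by simp
  then have "Stit i (Neg \<phi>) \<notin> X"
    using assms mcs_Neg[OF assms(1), of "Stit i (Neg \<phi>)"] by simp
  then show ?thesis
    using Stit_witness[OF assms(1,2), of "Neg \<phi>"] \<phi> mcs_Neg by auto
qed

text \<open>(GPerm) is applied to a conjunction containing \<open>F\<close> and true at
  \<open>Z\<close>. From the resulting \<open>U\<close>, each relevant agent \<open>i\<close>
  reaches some \<open>V\<close> containing the conjunction; a member \<open>Stit i \<psi>\<close> of
  \<open>F\<close> then passes from \<open>V\<close> back to \<open>U\<close>, since
  \<open>access i\<close> preserves it both ways.\<close>

lemma permutation_finite:
  assumes "mcs X" "mcs Y" "mcs Z" "l \<in> AGT" "m \<in> AGT" "n \<in> AGT"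
    and "access l X Y" "access m Y Z"
    and "finite F" "F \<subseteq> {Stit i \<psi> | i \<psi>. i \<in> AGT - {n} \<and> Stit i \<psi> \<in> Z}"
  shows "\<exists>U. mcs U \<and> access n X U \<and> F \<subseteq> U"
proof -
  obtain \<Gamma> where \<Gamma>: "set \<Gamma> = F"
    using finite_list[OF assms(9)] by blast
  \<comment> \<open>The inserted \<open>1\<close> ensures \<open>k \<ge> 1\<close>, and the
    intersection with \<open>AGT\<close> makes the maximum an agent.\<close>
  define k where "k = Max (insert 1 (\<Union> (agents ` F) \<inter> AGT))"
  have fin_agents: "finite (agents \<psi>)" for \<psi> :: "'a fm"
    by (induction \<psi>) auto
  then have fin: "finite (insert 1 (\<Union> (agents ` F) \<inter> AGT))"
    using assms(9) by blast
  have "k \<in> AGT"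
    using Max_in[OF fin] one_agent unfolding k_def by auto
  have "k \<ge> 1"
    using Max_ge[OF fin] unfolding k_def by blast
  have k: "i \<le> k" if "Stit i \<psi> \<in> F" for i \<psi>
  proof -
    have "i \<in> agents (Stit i \<psi>)" "i \<in> AGT"
      using that assms(10) by auto
    then have "i \<in> insert 1 (\<Union> (agents ` F) \<inter> AGT)"
      using that by blast
    then show ?thesis
      using Max_ge[OF fin] unfolding k_def by blast
  qed
  \<comment> \<open>An extra conjunct keeps the list nonempty when \<open>F\<close> is empty;
    \<open>Bot\<close> or its negation lies in \<open>Z\<close>.\<close>
  obtain \<phi> where "\<phi> \<in> Z"
    using mcs_Neg[OF assms(3), of Bot] by auto
  let ?\<chi> = "BigAnd (\<phi> # \<Gamma>)"
  let ?\<Phi> = "map (\<lambda>i. Dia i ?\<chi>) (filter (\<lambda>i. i \<noteq> n) [0..<Suc k])"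
  have \<chi>: "?\<chi> \<in> Z"
    using mcs_BigAnd[OF assms(3), of "\<phi> # \<Gamma>"] \<open>\<phi> \<in> Z\<close> \<Gamma> assms(10) by auto
  then have "Dia l (Dia m ?\<chi>) \<in> X"
    using access_Dia assms by blast
  then have "Dia n (BigAnd ?\<Phi>) \<in> X"
    using GPerm[OF \<open>k \<in> AGT\<close> \<open>k \<ge> 1\<close> assms(4-6) mcs_in_lang[OF assms(3) \<chi>]]
    by (rule mcs_Imp[OF assms(1), rotated])
  then obtain U where U: "mcs U" "access n X U" "BigAnd ?\<Phi> \<in> U"
    using Dia_witness assms by blast
  have "?\<Phi> \<noteq> []"
    using gperm_list_nonempty[OF \<open>k \<ge> 1\<close>] .
  then have \<Phi>: "set ?\<Phi> \<subseteq> U"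
    using mcs_BigAnd[OF U(1)] U(3) by blast
  have "\<gamma> \<in> U" if "\<gamma> \<in> F" for \<gamma>
  proof -
    from that assms(10) obtain i \<psi> where i: "\<gamma> = Stit i \<psi>" "i \<in> AGT" "i \<noteq> n"
      by blast
    then have "Dia i ?\<chi> \<in> set ?\<Phi>"
      unfolding set_gperm_list using k that by blast
    then have "Dia i ?\<chi> \<in> U"
      using \<Phi> by blast
    then obtain V where V: "mcs V" "access i U V" "?\<chi> \<in> V"
      using Dia_witness U(1) i(2) by blast
    then have "\<gamma> \<in> V"
      using mcs_BigAnd[OF V(1), of "\<phi> # \<Gamma>"] \<Gamma> that by auto
    then show ?thesis
      using V(2) i(1) by (simp add: access_def)
  qed
  then show ?thesis
    using U by blast
qed

lemma permutation_witness:
  assumes "mcs X" "mcs Y" "mcs Z" "l \<in> AGT" "m \<in> AGT" "n \<in> AGT"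
    and "access l X Y" "access m Y Z"
  shows "\<exists>U. mcs U \<and> access n X U \<and> (\<forall>i\<in>AGT - {n}. access i U Z)"
proof -
  let ?A = "{\<psi>. Stit n \<psi> \<in> X}"
  let ?B = "{Stit i \<psi> | i \<psi>. i \<in> AGT - {n} \<and> Stit i \<psi> \<in> Z}"
  have "consistent (?A \<union> ?B)"
  proof (rule consistent_finitary)
    fix F
    assume F: "finite F" "F \<subseteq> ?A \<union> ?B"
    \<comment> \<open>Only the demands coming from \<open>Z\<close> require (GPerm):
      \<open>?A\<close> is contained in every maximal consistent set that is
      \<open>n\<close>-accessible from \<open>X\<close>.\<close>
    obtain U where U: "mcs U" "access n X U" "F \<inter> ?B \<subseteq> U"
      using permutation_finite[OF assms, of "F \<inter> ?B"] F(1) by auto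
    then have "?A \<subseteq> U"
      using access_StitD assms(6) by blast
    then have "F \<subseteq> U"
      using F(2) U(3) by blast
    then show "consistent F"
      using U(1) consistent_subset by (auto simp: mcs_def)
  qed
  then obtain U where U: "mcs U" "?A \<union> ?B \<subseteq> U"
    by (rule lindenbaum)
  have "access n X U"
    by (rule accessI) (use U assms in auto)
  moreover have "access i U Z" if "i \<in> AGT - {n}" for i
  \<comment> \<open>\<open>?B\<close> transfers formulas from \<open>Z\<close> to \<open>U\<close>,
    so the one-sided criterion is checked in that direction.\<close>
  proof (rule access_sym, rule accessI)
    fix \<psi>
    assume "Stit i \<psi> \<in> Z"
    then have "Stit i \<psi> \<in> U"
      using that U(2) by blast
    then show "\<psi> \<in> U"
      using mcs_StitD[OF U(1)] that by blast
  qed (use U assms that in auto)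
  ultimately show ?thesis
    using U(1) by blast
qed

section \<open>The model on an infinite type\<close>

text \<open>Worlds are indices rather than sets, so that the model can live on a prescribed type;
  \<open>g\<close> may repeat values.\<close>

definition submodel :: "('w \<Rightarrow> 'p fm set) \<Rightarrow> ('w, 'p) model" where
  "submodel g = \<lparr>worlds = UNIV, rel = \<lambda>i. {(a, b). access i (g a) (g b)}, val = \<lambda>p. {a. Atm p \<in> g a}\<rparr>"

lemma kripke_model_submodel: "kripke_model AGT (submodel g)"
  by (auto simp: kripke_model_def submodel_def equiv_def refl_on_def sym_def trans_def access_def)

text \<open>The second hypothesis closes the range of \<open>g\<close> under counterexamples to
  \<open>Stit\<close>. Two such steps also settle \<open>Box\<close>, through
  \<open>mcs_Box\<close>.\<close>

lemma truth_lemma: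
  assumes "\<And>a. mcs (g a)"
    and "\<And>a i \<psi>. i \<in> AGT \<Longrightarrow> \<psi> \<in> lang AGT \<Longrightarrow> Stit i \<psi> \<notin> g a \<Longrightarrow>
           \<exists>b. access i (g a) (g b) \<and> \<psi> \<notin> g b"
  shows "\<phi> \<in> lang AGT \<Longrightarrow> sat (submodel g) a \<phi> \<longleftrightarrow> \<phi> \<in> g a"
proof (induction \<phi> arbitrary: a)
  case (Stit i \<phi>)
  then have "Stit i \<phi> \<in> g a \<longleftrightarrow> (\<forall>b. access i (g a) (g b) \<longrightarrow> \<phi> \<in> g b)"
    using access_StitD assms by (metis lang_simps(4))
  then show ?case
    using Stit by (simp add: submodel_def)
next
  case (Box \<phi>)
  have Stit: "Stit i \<psi> \<in> g a \<longleftrightarrow> (\<forall>b. access i (g a) (g b) \<longrightarrow> \<psi> \<in> g b)"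
    if "i \<in> AGT" "\<psi> \<in> lang AGT" for i \<psi> a
    using that access_StitD assms by metis
  have "\<phi> \<in> lang AGT"
    using Box.prems by simp
  then have "Box \<phi> \<in> g a \<longleftrightarrow> (\<forall>b. access 1 (g a) (g b) \<longrightarrow> (\<forall>c. access 0 (g b) (g c) \<longrightarrow> \<phi> \<in> g c))"
    using one_agent zero_agent mcs_Box[OF assms(1)] Stit[OF one_agent, of "Stit 0 \<phi>"]
      Stit[OF zero_agent, of \<phi>] by simp
  then show ?case
    using Box.IH[OF \<open>\<phi> \<in> lang AGT\<close>] by (simp add: submodel_def)
qed (use assms(1) in \<open>auto simp: mcs_Neg mcs_And submodel_def\<close>)

end

text \<open>Names for the worlds of the Skolem hull of a single world.\<close>

datatype 'p name =
    Root
  | Stit_Wit "'p name" nat "'p fm"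
  | Perm_Wit "'p name" "'p name" nat

instance name :: (countable) countable
  by countable_datatype

context agent_set
begin

text \<open>Where no witness exists, falling back on the first argument keeps every value maximal
  consistent.\<close>

primrec denote :: "'p fm set \<Rightarrow> 'p name \<Rightarrow> 'p fm set" where
  "denote X Root = X"
| "denote X (Stit_Wit s i \<phi>) =
     (let P = \<lambda>Y. mcs Y \<and> access i (denote X s) Y \<and> \<phi> \<notin> Y
      in if Ex P then Eps P else denote X s)"
| "denote X (Perm_Wit s t n) =
     (let P = \<lambda>Y. mcs Y \<and> access n (denote X s) Y \<and> (\<forall>i\<in>AGT - {n}. access i Y (denote X t))
      in if Ex P then Eps P else denote X s)"

section \<open>Named witnesses and completeness\<close>

lemma mcs_denote: "mcs X \<Longrightarrow> mcs (denote X s)"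
  by (induction s) (auto simp: Let_def intro: someI2)

lemma denote_Stit_Wit:
  assumes "\<exists>Y. mcs Y \<and> access i (denote X s) Y \<and> \<phi> \<notin> Y"
  shows "access i (denote X s) (denote X (Stit_Wit s i \<phi>)) \<and> \<phi> \<notin> denote X (Stit_Wit s i \<phi>)"
  using someI_ex[OF assms] assms by (simp add: Let_def)

lemma denote_Perm_Wit:
  assumes "\<exists>Y. mcs Y \<and> access n (denote X s) Y \<and> (\<forall>i\<in>AGT - {n}. access i Y (denote X t))"
  shows "access n (denote X s) (denote X (Perm_Wit s t n)) \<and>
    (\<forall>i\<in>AGT - {n}. access i (denote X (Perm_Wit s t n)) (denote X t))"
  using someI_ex[OF assms] assms by (simp add: Let_def)

lemma completeness:
  fixes \<phi> :: "'p::countable fm"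
  assumes "\<phi> \<in> lang AGT" "valid TYPE('w::infinite) AGT \<phi>"
  shows "provable AGT \<phi>"
proof (rule ccontr)
  assume "\<not> provable AGT \<phi>"
  have "consistent {Neg \<phi>}"
  proof (rule ccontr)
    assume "\<not> consistent {Neg \<phi>}"
    then obtain \<Gamma> where \<Gamma>: "set \<Gamma> \<subseteq> {}" "provable AGT (Imps \<Gamma> (Neg (Neg \<phi>)))"
      using inconsistent_insertD[of "{}" "Neg \<phi>"] assms(1) by auto
    then have "provable AGT \<phi>"
      using assms(1) by (intro provable_consequence[of "[Neg (Neg \<phi>)]"]) auto
    then show False
      using \<open>\<not> provable AGT \<phi>\<close> by contradiction
  qed
  then obtain X where X: "mcs X" "Neg \<phi> \<in> X"
    by (auto elim: lindenbaum)
  obtain f :: "nat \<Rightarrow> 'w" where "inj f"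
    using infinite_countable_subset[OF infinite_UNIV] by blast
  \<comment> \<open>\<open>inv f\<close> is onto the naturals and \<open>from_nat\<close> onto the
    names, so every name belongs to some world. Countability of the atoms enters here.\<close>
  define name :: "'w \<Rightarrow> 'p name" where "name = from_nat \<circ> inv f"
  have name: "\<exists>a. name a = s" for s
    using inv_f_f[OF \<open>inj f\<close>] unfolding name_def by (metis comp_apply from_nat_to_nat)
  let ?g = "denote X \<circ> name"
  let ?M = "submodel ?g"
  have mcs: "mcs (?g a)" for a
    using mcs_denote[OF X(1)] by simp
  have wit: "\<exists>b. access i (?g a) (?g b) \<and> \<psi> \<notin> ?g b"
    if "i \<in> AGT" "\<psi> \<in> lang AGT" "Stit i \<psi> \<notin> ?g a" for a i \<psi>
  proof -
    \<comment> \<open>The witness term is itself a name, so the hull already contains its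
      value.\<close>
    obtain b where "name b = Stit_Wit (name a) i \<psi>"
      using name by blast
    then show ?thesis
      using denote_Stit_Wit Stit_witness[OF mcs that] by (metis comp_apply)
  qed
  have "general_permutation AGT ?M"
    unfolding general_permutation_def
  proof (intro ballI impI)
    fix w v l m n
    assume agents: "l \<in> AGT" "m \<in> AGT" "n \<in> AGT" and "(w, v) \<in> rel ?M l O rel ?M m"
    then obtain x where "access l (?g w) (?g x)" "access m (?g x) (?g v)"
      by (auto simp: submodel_def)
    from permutation_witness[OF mcs mcs mcs agents this]
    have *: "\<exists>U. mcs U \<and> access n (?g w) U \<and> (\<forall>i\<in>AGT - {n}. access i U (?g v))" .
    obtain u where "name u = Perm_Wit (name w) (name v) n"
      using name by blast
    then have "access n (?g w) (?g u) \<and> (\<forall>i\<in>AGT - {n}. access i (?g u) (?g v))"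
      using denote_Perm_Wit * by (metis comp_apply)
    then show "\<exists>u\<in>worlds ?M. (w, u) \<in> rel ?M n \<and> (\<forall>i\<in>AGT - {n}. (u, v) \<in> rel ?M i)"
      by (auto simp: submodel_def)
  qed
  then have "sat ?M a \<phi>" for a
  proof -
    have "a \<in> worlds ?M"
      by (simp add: submodel_def)
    with \<open>general_permutation AGT ?M\<close> show ?thesis
      using assms(2) kripke_model_submodel unfolding valid_def by blast
  qed
  then have "\<phi> \<in> ?g a" for a
    using truth_lemma[OF mcs wit assms(1)] by blast
  \<comment> \<open>The world named \<open>Root\<close> denotes \<open>X\<close>, which contains the
    negation of \<open>\<phi>\<close>.\<close>
  moreover obtain a where "name a = Root"
    using name by blast
  ultimately have "\<phi> \<in> X"
    by (metis comp_apply denote.simps(1))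
  then show False
    using X mcs_Neg assms(1) by blast
qed

end

text \<open>Soundness holds over every type of worlds and the countermodel fits on any infinite one,
  so validity does not depend on the choice of \<open>'w\<close>.\<close>

theorem theorem4:
  fixes AGT :: "nat set" and \<phi> :: "'p::{countable,infinite} fm"
  assumes "\<And>i j. i \<in> AGT \<Longrightarrow> j \<le> i \<Longrightarrow> j \<in> AGT"
    and "infinite AGT \<or> card AGT \<ge> 2"
    and "\<phi> \<in> lang AGT"
  shows "valid TYPE('w::infinite) AGT \<phi> \<longleftrightarrow> provable AGT \<phi>"
proof -
  have "\<not> AGT \<subseteq> {0}"
    using assms(2) card_mono[of "{0}" AGT] finite_subset[of AGT "{0}"] by auto
  \<comment> \<open>A positive agent forces \<open>1\<close> into the initial segment.\<close>
  then obtain i where "i \<in> AGT" "1 \<le> i"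
    by (metis One_nat_def Suc_leI neq0_conv singletonI subsetI)
  then interpret agent_set AGT
    using assms(1) by unfold_locales blast+
  show ?thesis
  proof
    show "provable AGT \<phi>" if "valid TYPE('w) AGT \<phi>"
      using completeness[OF assms(3) that] .
    show "valid TYPE('w) AGT \<phi>" if "provable AGT \<phi>"
      unfolding valid_def by (blast intro: soundness[OF that])
  qed
qed

end
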